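(* For $n\ge 1$ let $M_n$ be the number of words $w=w_1\cdots w_n\in\{1,2,3,4,5\}^n$ such that $|w_i-w_{i+1}|\le 2$ for all $1\le i<n$. Then $$1+\sum_{n\ge 1}M_nt^n=\frac{1+t-t^2}{1-4t+t^3}.$$ *)

theory Defs
  imports "HOL-Computational_Algebra.Formal_Power_Series"
begin

text \<open>List positions start at 0, so \<open>w ! i\<close> is the letter $w_{i+1}$.\<close>

definition smooth_words :: "nat \<Rightarrow> int list set" where
  "smooth_words n =
    {w. length w = n \<and> set w \<subseteq> {1..5} \<and> (\<forall>i. Suc i < n \<longrightarrow> \<bar>w ! i - w ! Suc i\<bar> \<le> 2)}"

definition M :: "nat \<Rightarrow> nat" where
  "M n = card (smooth_words n)"

end

(* Words are counted by their first letter. The counts for the letters a and 6 - a agree, so the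
   transfer matrix acts on three counts (letters 1, 2, 3) only, and the linear recurrence
   M (n + 3) = 4 M (n + 2) - M n follows by elimination. It is the generating function identity
   multiplied by the denominator 1 - 4 t + t^3. *)

theory Submission
  imports Defs
begin

text \<open>The index is one less than the length, so these words are nonempty and \<open>hd\<close>
  is always their actual first letter.\<close>

definition smooth_words_from :: "nat \<Rightarrow> int \<Rightarrow> int list set" where
  "smooth_words_from n a = {w \<in> smooth_words (Suc n). hd w = a}"

lemma finite_smooth_words: "finite (smooth_words n)"
  by (rule finite_subset[OF _ finite_lists_length_eq[of "{1..5::int}" n]])
    (auto simp: smooth_words_def)

lemma finite_smooth_words_from: "finite (smooth_words_from n a)"
  by (simp add: smooth_words_from_def finite_smooth_words)

text \<open>The condition at position 0 compares \<open>a\<close> with the head of \<open>w\<close>;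
  the others shift down to \<open>w\<close>. Length at least two makes \<open>hd w\<close> a genuine
  second letter.\<close>

lemma Cons_mem_smooth_words:
  "a # w \<in> smooth_words (Suc (Suc n)) \<longleftrightarrow>
    a \<in> {1..5} \<and> w \<in> smooth_words (Suc n) \<and> \<bar>a - hd w\<bar> \<le> 2"
  by (cases w) (auto simp: smooth_words_def less_Suc_eq_0_disj nth_Cons split: nat.splits)

lemma smooth_words_from_Suc:
  assumes "a \<in> {1..5}"
  shows "smooth_words_from (Suc n) a =
    (\<Union>b\<in>{b \<in> {1..5}. \<bar>a - b\<bar> \<le> 2}. (#) a ` smooth_words_from n b)"
proof (intro set_eqI iffI)
  fix w assume w: "w \<in> smooth_words_from (Suc n) a"
  then obtain v where v: "w = a # v"
    by (cases w) (auto simp: smooth_words_from_def smooth_words_def)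
  with w have v': "v \<in> smooth_words (Suc n)" "\<bar>a - hd v\<bar> \<le> 2"
    by (auto simp: smooth_words_from_def Cons_mem_smooth_words)
  moreover from v' have "hd v \<in> {1..5}"
    by (cases v) (auto simp: smooth_words_def)
  ultimately show "w \<in> (\<Union>b\<in>{b \<in> {1..5}. \<bar>a - b\<bar> \<le> 2}. (#) a ` smooth_words_from n b)"
    using v by (auto simp: smooth_words_from_def)
qed (use assms in \<open>auto simp: smooth_words_from_def Cons_mem_smooth_words\<close>)

lemma card_smooth_words_from_Suc:
  assumes "a \<in> {1..5}"
  shows "card (smooth_words_from (Suc n) a) =
    (\<Sum>b | b \<in> {1..5} \<and> \<bar>a - b\<bar> \<le> 2. card (smooth_words_from n b))"
proof -
  have "finite {b \<in> {1..5}. \<bar>a - b\<bar> \<le> 2}"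
    by (rule finite_subset[of _ "{1..5}"]) auto
  \<comment> \<open>Words in different pieces of the union differ in their second letter.\<close>
  moreover have "(#) a ` smooth_words_from n b \<inter> (#) a ` smooth_words_from n c = {}"
    if "b \<noteq> c" for b c
    using that by (auto simp: smooth_words_from_def)
  ultimately show ?thesis
    unfolding smooth_words_from_Suc[OF assms]
    by (subst card_UN_disjoint) (simp_all add: finite_smooth_words_from card_image)
qed

lemma card_smooth_words_from_0:
  assumes "a \<in> {1..5}"
  shows "card (smooth_words_from 0 a) = 1"
proof -
  have "smooth_words_from 0 a = {[a]}"
    using assms by (auto simp: smooth_words_from_def smooth_words_def length_Suc_conv)
  then show ?thesis by simp
qed

lemma M_Suc: "M (Suc n) = (\<Sum>a\<in>{1..5}. card (smooth_words_from n a))"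
proof -
  have "hd w \<in> {1..5}" if "w \<in> smooth_words (Suc n)" for w
    using that by (cases w) (auto simp: smooth_words_def)
  then have "smooth_words (Suc n) = (\<Union>a\<in>{1..5}. smooth_words_from n a)"
    by (auto simp: smooth_words_from_def)
  then show ?thesis
    by (simp only: M_def, subst card_UN_disjoint)
      (auto simp: finite_smooth_words_from, auto simp: smooth_words_from_def)
qed

lemma letters: "{1..5} = {1, 2, 3, 4, 5::int}"
  by auto

lemma neighbour_sets:
  "{b. b \<in> {1..5} \<and> \<bar>1 - b\<bar> \<le> 2} = {1, 2, 3::int}"
  "{b. b \<in> {1..5} \<and> \<bar>2 - b\<bar> \<le> 2} = {1, 2, 3, 4::int}"
  "{b. b \<in> {1..5} \<and> \<bar>3 - b\<bar> \<le> 2} = {1, 2, 3, 4, 5::int}"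
  "{b. b \<in> {1..5} \<and> \<bar>4 - b\<bar> \<le> 2} = {2, 3, 4, 5::int}"
  "{b. b \<in> {1..5} \<and> \<bar>5 - b\<bar> \<le> 2} = {3, 4, 5::int}"
  by auto

lemmas card_smooth_words_from_Suc_letter =
  card_smooth_words_from_Suc[of 1, unfolded neighbour_sets]
  card_smooth_words_from_Suc[of 2, unfolded neighbour_sets]
  card_smooth_words_from_Suc[of 3, unfolded neighbour_sets]
  card_smooth_words_from_Suc[of 4, unfolded neighbour_sets]
  card_smooth_words_from_Suc[of 5, unfolded neighbour_sets]

text \<open>The reflection of letters a to 6 - a preserves distances, so it swaps the neighbours of
  1 with those of 5 and the neighbours of 2 with those of 4. Both equalities are needed together for
  the induction.\<close>

lemma card_smooth_words_from_symmetric: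
  "card (smooth_words_from n 5) = card (smooth_words_from n 1) \<and>
   card (smooth_words_from n 4) = card (smooth_words_from n 2)"
  by (induction n) (simp_all add: card_smooth_words_from_0 card_smooth_words_from_Suc_letter)

lemma M_0: "M 0 = 1"
proof -
  have "smooth_words 0 = {[]}" by (auto simp: smooth_words_def)
  then show ?thesis by (simp add: M_def)
qed

lemma M_initial: "M 1 = 5" "M 2 = 19" "M 3 = 75"
  by (simp_all add: numeral_2_eq_2 numeral_3_eq_3 M_Suc letters
      card_smooth_words_from_Suc_letter card_smooth_words_from_0)

text \<open>By Cayley-Hamilton: the matrix of \<open>step\<close>, with rows (1,1,1), (1,2,1),
  (2,2,1), has characteristic polynomial X^3 - 4 X^2 + 1. The additive form avoids truncated
  subtraction on \<open>nat\<close>.\<close>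

lemma M_recurrence: "M (n + 3) + M n = 4 * M (n + 2)"
proof (cases n)
  \<comment> \<open>The empty word has no first letter, so \<open>M 0\<close> is outside the reach
    of \<open>M_Suc\<close> and the initial values are used: 75 + 1 = 4 * 19.\<close>
  case 0
  then show ?thesis using M_initial M_0 by (simp add: numeral_2_eq_2)
next
  case (Suc m)
  define x y z where "x k = card (smooth_words_from k 1)"
    and "y k = card (smooth_words_from k 2)" and "z k = card (smooth_words_from k 3)" for k
  have M: "M (Suc k) = 2 * x k + 2 * y k + z k" for k
    using card_smooth_words_from_symmetric[of k] by (simp add: M_Suc letters x_def y_def z_def)
  have step: "x (Suc k) = x k + y k + z k" "y (Suc k) = x k + 2 * y k + z k"
    "z (Suc k) = 2 * x k + 2 * y k + z k" for k
    using card_smooth_words_from_symmetric[of k]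
    by (simp_all add: card_smooth_words_from_Suc_letter x_def y_def z_def)
  have "n + 3 = Suc (Suc (Suc (Suc m)))" "n + 2 = Suc (Suc (Suc m))"
    using Suc by simp_all
  \<comment> \<open>Both sides reduce to the same linear combination of \<open>x m\<close>,
    \<open>y m\<close> and \<open>z m\<close>.\<close>
  then show ?thesis
    unfolding Suc by (simp only: M step) (simp add: algebra_simps)
qed

theorem mainTheorem11:
  "1 + Abs_fps (\<lambda>n. if n \<ge> 1 then of_nat (M n) else 0) =
    (1 + fps_X - fps_X ^ 2) / (1 - 4 * fps_X + fps_X ^ 3 :: rat fps)"
proof -
  define F :: "rat fps" where "F = Abs_fps (\<lambda>n. of_nat (M n))"
  define D :: "rat fps" where "D = 1 - 4 * fps_X + fps_X ^ 3"
  \<comment> \<open>The summand 1 is the term of the empty word.\<close>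
  have F: "1 + Abs_fps (\<lambda>n. if n \<ge> 1 then of_nat (M n) else 0) = F"
    by (rule fps_ext) (auto simp: F_def M_0 not_le)
  have "fps_nth D 0 = 1"
    by (simp add: D_def fps_mult_nth)
  then have D: "D \<noteq> 0"
    by auto
  have "F * D = 1 + fps_X - fps_X ^ 2"
  proof (rule fps_ext)
    fix n
    have "F * D = F - fps_const 4 * (F * fps_X) + F * fps_X ^ 3"
      by (simp add: D_def algebra_simps numeral_fps_const)
    then have coeff: "fps_nth (F * D) n = fps_nth F n - 4 * (if n = 0 then 0 else fps_nth F (n - 1))
        + (if n < 3 then 0 else fps_nth F (n - 3))"
      by (simp add: fps_X_power_mult_right_nth)
    \<comment> \<open>Below 3 the cubic term is absent and the initial values yield the numerator:
      1, 5 - 4 = 1, 19 - 20 = -1. From 3 on the recurrence makes every coefficient vanish.\<close>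
    consider "n = 0" | "n = 1" | "n = 2" | m where "n = m + 3"
    proof -
      have "n = 0 \<or> n = 1 \<or> n = 2 \<or> (\<exists>m. n = m + 3)"
        by presburger
      then show thesis
        using that by blast
    qed
    then show "fps_nth (F * D) n = fps_nth (1 + fps_X - fps_X ^ 2) n"
    proof cases
      case 4
      have "rat_of_nat (M (m + 3)) + of_nat (M m) = 4 * of_nat (M (m + 2))"
        using arg_cong[OF M_recurrence[of m], of rat_of_nat] by simp
      moreover have "m + 3 - 1 = m + 2" by simp
      ultimately show ?thesis
        unfolding coeff unfolding 4 F_def by simp
    qed (unfold coeff, use M_0 M_initial in \<open>simp_all add: F_def\<close>)
  qed
  then have "(1 + fps_X - fps_X ^ 2) / D = F"
    using D by (metis nonzero_mult_div_cancel_right)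
  then show ?thesis
    unfolding F D_def by (rule sym)
qed

end
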